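(* Let $\beta\in\{3,4\}$, let $n\ge 1$, and let $H=[A_{s,t}]_{1\le s,t\le\beta}\in\mathbb{M}_{\beta n}(\mathbb{C})$ be a positive semidefinite matrix partitioned into $\beta\times\beta$ blocks $A_{s,t}\in\mathbb{M}_n(\mathbb{C})$, all of which are Hermitian. Let $\Delta=\sum_{s=1}^{\beta}A_{s,s}$ be the sum of its diagonal blocks. Then there exist isometries $V_k\in\mathbb{M}_{2\beta n,2n}(\mathbb{C})$, $k=1,2,3,4$, such that $$H\oplus H=\frac{1}{4}\sum_{k=1}^4 V_k(\Delta\oplus\Delta)V_k^*.$$
   Context: $\mathbb{M}_n(\mathbb{C})$ is the algebra of $n\times n$ complex matrices. $\mathbb{M}_{p,q}(\mathbb{C})$ is the space of complex matrices with $p$ rows and $q$ columns; $V\in\mathbb{M}_{p,q}(\mathbb{C})$ is an isometry if $p\ge q$ and $V^*V=I_q$. $A\oplus B$ denotes the block-diagonal matrix $\begin{bmatrix} A&0\\0&B\end{bmatrix}$. *)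

theory Defs
  imports "Jordan_Normal_Form.Schur_Decomposition"
begin

definition hermitian_mat :: "complex mat \<Rightarrow> bool" where
  "hermitian_mat A \<longleftrightarrow> mat_adjoint A = A"

text \<open>The scalar product \<open>x \<bullet>c v\<close> is conjugated in its second argument, so the term below is
  $v^* A v$. The order on \<^typ>\<open>complex\<close> is the one in which \<open>0 \<le> z\<close> means that \<open>z\<close> is real
  and nonnegative.\<close>

definition psd_mat :: "complex mat \<Rightarrow> bool" where
  "psd_mat A \<longleftrightarrow> hermitian_mat A \<and>
     (\<forall>v \<in> carrier_vec (dim_row A). 0 \<le> (A *\<^sub>v v) \<bullet>c v)"

definition isometry_mat :: "nat \<Rightarrow> nat \<Rightarrow> complex mat \<Rightarrow> bool" where
  "isometry_mat p q V \<longleftrightarrow> V \<in> carrier_mat p q \<and> q \<le> p \<and> mat_adjoint V * V = 1\<^sub>m q"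

text \<open>The \<open>n \<times> n\<close> block in position \<open>(s, t)\<close>, with block indices counted from \<open>0\<close> like
  the row and column indices of matrices.\<close>

definition block :: "nat \<Rightarrow> 'a mat \<Rightarrow> nat \<Rightarrow> nat \<Rightarrow> 'a mat" where
  "block n H s t = mat n n (\<lambda>(i, j). H $$ (s * n + i, t * n + j))"

text \<open>The type of matrices of all sizes is not an additive monoid, so \<^const>\<open>sum\<close> does not apply
  to it. This is the sum of a family of \<open>nr \<times> nc\<close> matrices.\<close>

definition mat_sum :: "nat \<Rightarrow> nat \<Rightarrow> ('i \<Rightarrow> 'a::comm_monoid_add mat) \<Rightarrow> 'i set \<Rightarrow> 'a mat" where
  "mat_sum nr nc f I = mat nr nc (\<lambda>ij. \<Sum>k\<in>I. f k $$ ij)"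

abbreviation direct_sum_mat :: "'a::zero mat \<Rightarrow> 'a mat \<Rightarrow> 'a mat" (infixr "\<oplus>\<^sub>m" 65) where
  "A \<oplus>\<^sub>m B \<equiv> diag_block_mat [A, B]"

end

theory Submission
  imports Defs "HOL-Computational_Algebra.Fundamental_Theorem_Algebra"
begin

text \<open>
  Write \<open>M = H \<oplus> H\<close> and \<open>G = \<Delta> \<oplus> \<Delta>\<close>. As \<open>H\<close> and all its blocks are Hermitian,
  the blocks satisfy \<open>A\<^sub>s\<^sub>t = A\<^sub>t\<^sub>s\<close>, so a combination \<open>\<Sum> g(s,t) A\<^sub>s\<^sub>t\<close> depends only on the
  symmetric part of the coefficients \<open>g\<close>. The quaternion units \<open>1, i, j, k\<close>, seen as
  \<open>2 \<times> 2\<close> matrices \<open>u\<^sub>0, \<dots>, u\<^sub>3\<close>, satisfy \<open>u\<^sub>s u\<^sub>t\<^sup>* + u\<^sub>t u\<^sub>s\<^sup>* = 2 \<delta>\<^sub>s\<^sub>t\<close>; hence conjugating \<open>M\<close> with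
  the block row \<open>Z = (c\<^sub>s u\<^sub>s \<otimes> I)\<^sub>s\<close> annihilates all contributions with \<open>s \<noteq> t\<close> and
  leaves \<open>Z M Z\<^sup>* = G / 4\<close> whenever the real scalars \<open>c\<^sub>s\<close> are \<open>1/2\<close> or \<open>-1/2\<close>
  (\<open>quaternion_row_compression\<close>). There are four quaternion units, which is why \<open>\<beta>\<close> is at most 4;
  for \<open>\<beta> = 3\<close> one of them is left out.

  Taking the signs from the rows of a \<open>4 \<times> 4\<close> Hadamard matrix gives four such block rows
  \<open>Z\<^sub>1, \<dots>, Z\<^sub>4\<close> with \<open>\<Sum> Z\<^sub>k\<^sup>* Z\<^sub>k = I\<close> (\<open>quaternion_row_resolution\<close>). If \<open>T\<close> is a Hermitian
  square root of \<open>M\<close>, then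
  \<open>M = T I T = \<Sum> (T Z\<^sub>k\<^sup>*) (T Z\<^sub>k\<^sup>*)\<^sup>*\<close>, while \<open>(T Z\<^sub>k\<^sup>*)\<^sup>* (T Z\<^sub>k\<^sup>*) = Z\<^sub>k M Z\<^sub>k\<^sup>* = G / 4\<close>.
  By polar decomposition \<open>R R\<^sup>*\<close> arises from \<open>R\<^sup>* R\<close> by conjugation with an isometry, provided
  that \<open>R\<close> has at least as many rows as columns (\<open>isometry_conjugates_gram\<close>). Applied to
  \<open>R = T Z\<^sub>k\<^sup>*\<close> this yields \<open>V\<^sub>k\<close>, and \<open>M = \<Sum> V\<^sub>k (G / 4) V\<^sub>k\<^sup>*\<close>.

  The square root and the polar decomposition both rest on the spectral theorem for Hermitian
  matrices.
\<close>

section \<open>Adjoints and matrix products\<close>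

notation mat_adjoint ("_\<^sup>\<dagger>" [1000] 999)

lemma adjoint_dim [simp]: "dim_row (A\<^sup>\<dagger>) = dim_col A" "dim_col (A\<^sup>\<dagger>) = dim_row A"
  by (simp_all add: mat_adjoint_def)

lemma adjoint_carrier [simp]: "A \<in> carrier_mat n m \<Longrightarrow> A\<^sup>\<dagger> \<in> carrier_mat m n"
  by (intro carrier_matI) auto

lemma adjoint_index [simp]:
  "i < dim_col A \<Longrightarrow> j < dim_row A \<Longrightarrow> (A\<^sup>\<dagger>) $$ (i, j) = conjugate (A $$ (j, i))"
  by (simp add: mat_adjoint_def mat_of_rows_def)

lemma adjoint_adjoint [simp]: "(A\<^sup>\<dagger>)\<^sup>\<dagger> = A"
  by (rule eq_matI) auto

lemma mult_mat_index_sum: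
  assumes "A \<in> carrier_mat n m" "B \<in> carrier_mat m p" "i < n" "j < p"
  shows "(A * B) $$ (i, j) = (\<Sum>x<m. A $$ (i, x) * B $$ (x, j))"
  using assms by (auto simp: scalar_prod_def atLeast0LessThan intro!: sum.cong)

text \<open>Associativity with hypotheses on dimensions alone, which the simplifier can discharge for nested
  products without being told the intermediate sizes.\<close>
lemma mult_mat_assoc:
  fixes A :: "'a::semiring_0 mat"
  assumes "dim_col A = dim_row B" "dim_col B = dim_row C"
  shows "A * B * C = A * (B * C)"
  by (rule assoc_mult_mat[of A "dim_row A" "dim_row B" B "dim_row C" C "dim_col C"])
     (use assms in \<open>auto intro: carrier_matI\<close>)

lemma adjoint_mult:
  assumes A: "A \<in> carrier_mat n m" and B: "B \<in> carrier_mat m p"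
  shows "(A * B)\<^sup>\<dagger> = B\<^sup>\<dagger> * A\<^sup>\<dagger>"
proof (rule eq_matI)
  fix i j assume ij: "i < dim_row (B\<^sup>\<dagger> * A\<^sup>\<dagger>)" "j < dim_col (B\<^sup>\<dagger> * A\<^sup>\<dagger>)"
  then have i: "i < p" and j: "j < n" using A B by auto
  have "((A * B)\<^sup>\<dagger>) $$ (i, j) = conjugate ((A * B) $$ (j, i))"
    using A B i j by simp
  also have "\<dots> = (\<Sum>x<m. (B\<^sup>\<dagger>) $$ (i, x) * (A\<^sup>\<dagger>) $$ (x, j))"
    using A B i j by (simp add: mult_mat_index_sum[OF A B] sum_conjugate conjugate_dist_mul mult.commute
        del: index_mult_mat)
  also have "\<dots> = (B\<^sup>\<dagger> * A\<^sup>\<dagger>) $$ (i, j)"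
    using mult_mat_index_sum[of "B\<^sup>\<dagger>" p m "A\<^sup>\<dagger>" n] A B i j by simp
  finally show "((A * B)\<^sup>\<dagger>) $$ (i, j) = (B\<^sup>\<dagger> * A\<^sup>\<dagger>) $$ (i, j)" .
qed (use A B in auto)

lemma adjoint_mult_dim: "dim_col A = dim_row B \<Longrightarrow> (A * B)\<^sup>\<dagger> = B\<^sup>\<dagger> * A\<^sup>\<dagger>"
  by (rule adjoint_mult[of A "dim_row A" "dim_row B" B "dim_col B"]) (auto intro: carrier_matI)

lemma adjoint_four_block:
  assumes "A \<in> carrier_mat n1 m1" "B \<in> carrier_mat n1 m2"
    "C \<in> carrier_mat n2 m1" "D \<in> carrier_mat n2 m2"
  shows "(four_block_mat A B C D)\<^sup>\<dagger> = four_block_mat (A\<^sup>\<dagger>) (C\<^sup>\<dagger>) (B\<^sup>\<dagger>) (D\<^sup>\<dagger>)"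
  by (rule eq_matI) (use assms in auto)

lemma adjoint_zero: "(0\<^sub>m n m :: complex mat)\<^sup>\<dagger> = 0\<^sub>m m n"
  by (rule eq_matI) auto

lemma adjoint_one: "(1\<^sub>m n :: complex mat)\<^sup>\<dagger> = 1\<^sub>m n"
  by (rule eq_matI) auto

section \<open>Orthonormal families\<close>

text \<open>The family is indexed by an arbitrary set of indices rather than by an initial segment, because
  \<open>isometry_conjugates_gram\<close> has to extend a family whose index set has gaps.\<close>
definition orthonormal_on :: "nat \<Rightarrow> (nat \<Rightarrow> complex vec) \<Rightarrow> nat set \<Rightarrow> bool" where
  "orthonormal_on m u I \<longleftrightarrow> (\<forall>i\<in>I. u i \<in> carrier_vec m) \<and>
     (\<forall>i\<in>I. \<forall>j\<in>I. u i \<bullet>c u j = (if i = j then 1 else 0))"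

lemma exists_unit_scaling:
  assumes v: "(v :: complex vec) \<in> carrier_vec m" and v0: "v \<noteq> 0\<^sub>v m"
  obtains a where "(a \<cdot>\<^sub>v v) \<bullet>c (a \<cdot>\<^sub>v v) = 1"
proof -
  have pos: "v \<bullet>c v > 0" using v v0 by simp
  define r where "r = Re (v \<bullet>c v)"
  have r: "v \<bullet>c v = of_real r" "r > 0"
    using pos by (auto simp: r_def less_complex_def complex_eq_iff)
  let ?a = "of_real (1 / sqrt r) :: complex"
  have "(?a \<cdot>\<^sub>v v) \<bullet>c (?a \<cdot>\<^sub>v v) = ?a * cnj ?a * (v \<bullet>c v)"
    using v by (simp add: conjugate_smult_vec)
  also have "\<dots> = of_real (1 / sqrt r * (1 / sqrt r) * r)"
    unfolding r(1) by (simp only: complex_cnj_complex_of_real of_real_mult)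
  also have "\<dots> = 1" using r(2) by (simp add: field_simps flip: power2_eq_square)
  finally show thesis by (rule that)
qed

text \<open>Fewer than \<open>m\<close> homogeneous linear equations in \<open>m\<close> unknowns have a nonzero solution.\<close>
lemma exists_unit_orthogonal:
  assumes fin: "finite J" and card: "card J < m" and u: "\<And>i. i \<in> J \<Longrightarrow> u i \<in> carrier_vec m"
  obtains v :: "complex vec"
    where "v \<in> carrier_vec m" "v \<bullet>c v = 1" "\<And>i. i \<in> J \<Longrightarrow> v \<bullet>c u i = 0"
proof -
  obtain f where f: "bij_betw f {0..<card J} J"
    using ex_bij_betw_nat_finite[OF fin] by blast
  define R where "R r = (if r < card J then conjugate (u (f r)) else 0\<^sub>v m)" for r
  \<comment> \<open>Padded with zero rows to a square matrix; the zero row with index \<open>card J\<close> makes it singular.\<close>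
  define K where "K = mat\<^sub>r m m (\<lambda>r. if r = card J then 0\<^sub>v m else R r)"
  have R: "R r \<in> carrier_vec m" for r
    using f u by (fastforce simp: R_def bij_betw_def intro!: carrier_vec_conjugate)
  have K: "K \<in> carrier_mat m m" by (simp add: K_def)
  have "det K = 0" unfolding K_def
    by (rule det_row_0[OF card]) (use R in auto)
  then obtain w where w: "w \<in> carrier_vec m" "w \<noteq> 0\<^sub>v m" "K *\<^sub>v w = 0\<^sub>v m"
    using det_0_iff_vec_prod_zero[OF K] by blast
  have w_orth: "w \<bullet>c u i = 0" if i: "i \<in> J" for i
  proof -
    obtain r where r: "r < card J" "i = f r"
      using f i by (metis atLeastLessThan_iff bij_betw_imp_surj_on imageE)
    have "0 = (K *\<^sub>v w) $ r" using w(3) r card by simp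
    also have "\<dots> = conjugate (u i) \<bullet> w"
      using r card carrier_vecD[OF R[of r]] by (simp add: K_def R_def)
    also have "\<dots> = w \<bullet>c u i"
      using comm_scalar_prod[OF _ w(1), of "conjugate (u i)"] u[OF i] by simp
    finally show ?thesis by simp
  qed
  obtain a where a: "(a \<cdot>\<^sub>v w) \<bullet>c (a \<cdot>\<^sub>v w) = 1" using exists_unit_scaling[OF w(1,2)] .
  show thesis
    by (rule that[OF _ a]) (use w(1) u w_orth in auto)
qed

lemma orthonormal_extension:
  assumes "finite I" "J \<subseteq> I" "card I \<le> m" "orthonormal_on m u J"
  obtains w where "orthonormal_on m w I" "\<And>i. i \<in> J \<Longrightarrow> w i = u i"
proof -
  have "\<exists>w. orthonormal_on m w (J \<union> K) \<and> (\<forall>i\<in>J. w i = u i)"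
    if "finite K" "K \<subseteq> I - J" for K
    using that
  proof (induction K rule: finite_induct)
    case empty
    then show ?case using assms by auto
  next
    case (insert x K)
    then obtain w where w: "orthonormal_on m w (J \<union> K)" "\<forall>i\<in>J. w i = u i" by auto
    have x: "x \<notin> J \<union> K" using insert by auto
    have fin: "finite (J \<union> K)"
      using insert(1) assms(1,2) finite_subset by blast
    have "card (J \<union> K) < card I"
      by (rule psubset_card_mono[OF assms(1)]) (use insert assms(2) x in blast)
    then have card: "card (J \<union> K) < m" using assms(3) by simp
    obtain v where v: "v \<in> carrier_vec m" "v \<bullet>c v = 1" "\<And>i. i \<in> J \<union> K \<Longrightarrow> v \<bullet>c w i = 0"
      using exists_unit_orthogonal[OF fin card, of w] w(1) by (auto simp: orthonormal_on_def)
    have v': "w i \<bullet>c v = 0" if "i \<in> J \<union> K" for i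
    proof -
      have "w i \<in> carrier_vec m" using w(1) that by (auto simp: orthonormal_on_def)
      then have "w i \<bullet>c v = conjugate (v \<bullet>c w i)"
        using v(1) by (metis conjugate_conjugate_sprod conjugate_vec_sprod_comm carrier_vec_conjugate)
      then show ?thesis using v(3)[OF that] by simp
    qed
    have "orthonormal_on m (w(x := v)) (J \<union> insert x K)"
      using w(1) v v' x unfolding orthonormal_on_def by auto
    moreover have "\<forall>i\<in>J. (w(x := v)) i = u i" using w(2) x by auto
    ultimately show ?case by blast
  qed
  from this[of "I - J"] show thesis
    using assms that by (auto simp: Un_absorb1)
qed

lemma isometry_of_orthonormal:
  assumes "orthonormal_on m u {..<p}" "p \<le> m"
  shows "isometry_mat m p (mat m p (\<lambda>(x, i). u i $ x))"
proof -
  let ?Q = "mat m p (\<lambda>(x, i). u i $ x)"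
  have "?Q\<^sup>\<dagger> * ?Q = 1\<^sub>m p"
  proof (rule eq_matI)
    fix i j assume "i < dim_row (1\<^sub>m p :: complex mat)" "j < dim_col (1\<^sub>m p :: complex mat)"
    then have ij: "i < p" "j < p" by auto
    have u: "u i \<in> carrier_vec m" "u j \<in> carrier_vec m"
      using assms ij by (auto simp: orthonormal_on_def)
    have "(?Q\<^sup>\<dagger> * ?Q) $$ (i, j) = (\<Sum>x<m. (?Q\<^sup>\<dagger>) $$ (i, x) * ?Q $$ (x, j))"
      by (rule mult_mat_index_sum[of _ p m]) (use ij in auto)
    also have "\<dots> = u j \<bullet>c u i"
      using u ij by (auto simp: scalar_prod_def atLeast0LessThan mult.commute intro!: sum.cong)
    also have "\<dots> = 1\<^sub>m p $$ (i, j)" using assms ij by (auto simp: orthonormal_on_def)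
    finally show "(?Q\<^sup>\<dagger> * ?Q) $$ (i, j) = 1\<^sub>m p $$ (i, j)" .
  qed auto
  then show ?thesis using assms by (simp add: isometry_mat_def)
qed

section \<open>The spectral theorem and square roots\<close>

definition real_diag :: "nat \<Rightarrow> (nat \<Rightarrow> real) \<Rightarrow> complex mat" where
  "real_diag n d = mat n n (\<lambda>(i, j). if i = j then complex_of_real (d i) else 0)"

lemma real_diag_carrier [simp]: "real_diag n d \<in> carrier_mat n n"
  by (simp add: real_diag_def)

lemma real_diag_dim [simp]: "dim_row (real_diag n d) = n" "dim_col (real_diag n d) = n"
  by (simp_all add: real_diag_def)

lemma real_diag_adjoint: "(real_diag n d)\<^sup>\<dagger> = real_diag n d"
  by (rule eq_matI) (auto simp: real_diag_def)

lemma mult_real_diag_index: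
  assumes A: "A \<in> carrier_mat m n" and ij: "i < m" "j < n"
  shows "(A * real_diag n d) $$ (i, j) = A $$ (i, j) * complex_of_real (d j)"
proof -
  have "(A * real_diag n d) $$ (i, j) = (\<Sum>x<n. if x = j then A $$ (i, j) * complex_of_real (d j) else 0)"
    unfolding mult_mat_index_sum[OF A real_diag_carrier ij]
    by (rule sum.cong) (use ij in \<open>auto simp: real_diag_def\<close>)
  then show ?thesis using ij by simp
qed

lemma real_diag_mult: "real_diag n d * real_diag n e = real_diag n (\<lambda>i. d i * e i)"
proof (rule eq_matI)
  fix i j assume "i < dim_row (real_diag n (\<lambda>i. d i * e i))" "j < dim_col (real_diag n (\<lambda>i. d i * e i))"
  then have ij: "i < n" "j < n" by auto
  show "(real_diag n d * real_diag n e) $$ (i, j) = real_diag n (\<lambda>i. d i * e i) $$ (i, j)"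
    unfolding mult_real_diag_index[OF real_diag_carrier ij] using ij by (simp add: real_diag_def)
qed auto

lemma real_diag_Suc:
  "real_diag (Suc m) (case_nat l d) =
     four_block_mat (mat 1 1 (\<lambda>_. complex_of_real l)) (0\<^sub>m 1 m) (0\<^sub>m m 1) (real_diag m d)"
  by (rule eq_matI) (auto simp: real_diag_def split: nat.split)

definition unitary_mat :: "nat \<Rightarrow> complex mat \<Rightarrow> bool" where
  "unitary_mat n U \<longleftrightarrow> U \<in> carrier_mat n n \<and> U\<^sup>\<dagger> * U = 1\<^sub>m n \<and> U * U\<^sup>\<dagger> = 1\<^sub>m n"

lemma unitary_if_isometry: "isometry_mat n n U \<Longrightarrow> unitary_mat n U"
  using mat_mult_left_right_inverse[of "U\<^sup>\<dagger>" n U] by (auto simp: isometry_mat_def unitary_mat_def)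

lemma unitary_mult:
  assumes "unitary_mat n U" "unitary_mat n V"
  shows "unitary_mat n (U * V)"
proof -
  have c: "U \<in> carrier_mat n n" "V \<in> carrier_mat n n" "U\<^sup>\<dagger> \<in> carrier_mat n n" "V\<^sup>\<dagger> \<in> carrier_mat n n"
    using assms by (auto simp: unitary_mat_def)
  note [simp] = c(1)[THEN carrier_matD(1)] c(1)[THEN carrier_matD(2)] c(2)[THEN carrier_matD(1)] c(2)[THEN carrier_matD(2)]
  have "(V\<^sup>\<dagger> * U\<^sup>\<dagger>) * (U * V) = V\<^sup>\<dagger> * (U\<^sup>\<dagger> * U) * V"
    using c by (simp add: mult_mat_assoc)
  moreover have "(U * V) * (V\<^sup>\<dagger> * U\<^sup>\<dagger>) = U * (V * V\<^sup>\<dagger>) * U\<^sup>\<dagger>"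
    using c by (simp add: mult_mat_assoc)
  ultimately show ?thesis
    using assms c by (simp add: unitary_mat_def adjoint_mult[of U n n V n])
qed

lemma exists_unit_eigenvector:
  assumes A: "A \<in> carrier_mat n n" and n: "n > 0"
  obtains v l where "v \<in> carrier_vec n" "v \<bullet>c v = 1" "A *\<^sub>v v = (l :: complex) \<cdot>\<^sub>v v"
proof -
  have "degree (char_poly A) = n" using degree_monic_char_poly[OF A] by simp
  then have "\<not> constant (poly (char_poly A))" using n by (simp add: constant_degree)
  then obtain l where "poly (char_poly A) l = 0" using fundamental_theorem_of_algebra by blast
  then have "eigenvalue A l" using eigenvalue_root_char_poly[OF A] by simp
  then obtain w where w: "w \<in> carrier_vec n" "w \<noteq> 0\<^sub>v n" "A *\<^sub>v w = l \<cdot>\<^sub>v w"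
    using A by (auto simp: eigenvalue_def eigenvector_def)
  obtain a where a: "(a \<cdot>\<^sub>v w) \<bullet>c (a \<cdot>\<^sub>v w) = 1" using exists_unit_scaling[OF w(1,2)] .
  have "A *\<^sub>v (a \<cdot>\<^sub>v w) = a \<cdot>\<^sub>v (l \<cdot>\<^sub>v w)"
    using mult_mat_vec[OF A w(1)] w(3) by simp
  also have "\<dots> = l \<cdot>\<^sub>v (a \<cdot>\<^sub>v w)" by (simp add: smult_smult_assoc mult.commute)
  finally show thesis using that[OF _ a] w(1) by simp
qed

text \<open>Induction on the size. In an orthonormal basis that starts with an eigenvector, the first column
  of the matrix is a multiple of the first unit vector; being Hermitian, the matrix then splits off
  a \<open>1 \<times> 1\<close> block with a real entry, and the remaining block is diagonalised by induction.\<close>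
theorem spectral_theorem_hermitian:
  assumes "A \<in> carrier_mat n n" "hermitian_mat A"
  shows "\<exists>U d. unitary_mat n U \<and> A = U * real_diag n d * U\<^sup>\<dagger>"
  using assms
proof (induction n arbitrary: A)
  case 0
  have "unitary_mat 0 (1\<^sub>m 0)" by (simp add: unitary_mat_def adjoint_one)
  moreover have "A = 1\<^sub>m 0 * real_diag 0 (\<lambda>_. 0) * (1\<^sub>m 0)\<^sup>\<dagger>"
    using 0 by (intro eq_matI) auto
  ultimately show ?case by blast
next
  case (Suc m)
  let ?n = "Suc m"
  note A = Suc.prems(1)
  have Ah: "A\<^sup>\<dagger> = A" using Suc.prems(2) by (simp add: hermitian_mat_def)
  obtain v l where v: "v \<in> carrier_vec ?n" "v \<bullet>c v = 1" "A *\<^sub>v v = (l :: complex) \<cdot>\<^sub>v v"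
    using exists_unit_eigenvector[OF A] by auto
  have "orthonormal_on ?n (\<lambda>_. v) {0}" using v by (simp add: orthonormal_on_def)
  then obtain u where u: "orthonormal_on ?n u {..<?n}" "u 0 = v"
    using orthonormal_extension[of "{..<?n}" "{0}" ?n "\<lambda>_. v"] by auto
  define U where "U = mat ?n ?n (\<lambda>(x, i). u i $ x)"
  have U: "unitary_mat ?n U"
    unfolding U_def by (rule unitary_if_isometry, rule isometry_of_orthonormal) (use u in auto)
  have c: "U \<in> carrier_mat ?n ?n" "U\<^sup>\<dagger> \<in> carrier_mat ?n ?n" by (auto simp: U_def)
  note [simp] = c(1)[THEN carrier_matD(1)] c(1)[THEN carrier_matD(2)] A[THEN carrier_matD(1)] A[THEN carrier_matD(2)]
  have UU: "U\<^sup>\<dagger> * U = 1\<^sub>m ?n" "U * U\<^sup>\<dagger> = 1\<^sub>m ?n" using U by (auto simp: unitary_mat_def)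
  define B where "B = U\<^sup>\<dagger> * A * U"
  have B: "B \<in> carrier_mat ?n ?n" using c A by (auto simp: B_def)
  have Bh: "B\<^sup>\<dagger> = B"
    using c A Ah by (simp add: B_def adjoint_mult_dim mult_mat_assoc)
  have col0: "U *\<^sub>v unit_vec ?n 0 = v"
    using v(1) u(2) by (intro eq_vecI) (auto simp: U_def)
  have "B *\<^sub>v unit_vec ?n 0 = U\<^sup>\<dagger> *\<^sub>v (A *\<^sub>v (U *\<^sub>v unit_vec ?n 0))"
    unfolding B_def using c A by (simp add: assoc_mult_mat_vec[of _ ?n ?n _ ?n] mult_mat_assoc)
  also have "\<dots> = l \<cdot>\<^sub>v (U\<^sup>\<dagger> *\<^sub>v (U *\<^sub>v unit_vec ?n 0))"
    unfolding col0 v(3) using mult_mat_vec[OF c(2) v(1)] .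
  also have "U\<^sup>\<dagger> *\<^sub>v (U *\<^sub>v unit_vec ?n 0) = unit_vec ?n 0"
    using assoc_mult_mat_vec[OF c(2,1), of "unit_vec ?n 0"] UU by simp
  finally have Bcol: "B *\<^sub>v unit_vec ?n 0 = l \<cdot>\<^sub>v unit_vec ?n 0" .
  have B0: "B $$ (i, 0) = (if i = 0 then l else 0)" if "i < ?n" for i
    using arg_cong[OF Bcol, of "\<lambda>w. w $ i"] that B by simp
  have Bsym: "B $$ (i, j) = cnj (B $$ (j, i))" if "i < ?n" "j < ?n" for i j
    using arg_cong[OF Bh, of "\<lambda>M. M $$ (i, j)"] that B by simp
  have l: "l = complex_of_real (Re l)"
    using Bsym[of 0 0] B0[of 0] by (simp add: complex_eq_iff)
  have l': "cnj l = l" by (subst (1 2) l) simp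
  define B' where "B' = mat m m (\<lambda>(i, j). B $$ (Suc i, Suc j))"
  have "hermitian_mat B'" unfolding hermitian_mat_def
    by (rule eq_matI) (auto simp: B'_def intro: Bsym[symmetric])
  then obtain W d where W: "unitary_mat m W" "B' = W * real_diag m d * W\<^sup>\<dagger>"
    using Suc.IH[of B'] by (auto simp: B'_def)
  have Wc: "W \<in> carrier_mat m m" "W\<^sup>\<dagger> \<in> carrier_mat m m" using W(1) by (auto simp: unitary_mat_def)
  let ?e = "1\<^sub>m 1 :: complex mat"
  let ?l = "mat 1 1 (\<lambda>_. complex_of_real (Re l))"
  define V where "V = four_block_mat ?e (0\<^sub>m 1 m) (0\<^sub>m m 1) W"
  have Vad: "V\<^sup>\<dagger> = four_block_mat ?e (0\<^sub>m 1 m) (0\<^sub>m m 1) (W\<^sup>\<dagger>)"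
    unfolding V_def by (subst adjoint_four_block) (use Wc in \<open>auto simp: adjoint_one adjoint_zero\<close>)
  have V: "unitary_mat ?n V"
  proof -
    have "V \<in> carrier_mat ?n ?n" unfolding V_def using Wc by (intro carrier_matI) auto
    moreover have "V\<^sup>\<dagger> * V = 1\<^sub>m (1 + m)" "V * V\<^sup>\<dagger> = 1\<^sub>m (1 + m)"
      unfolding Vad unfolding V_def using W(1) Wc
      by (simp_all add: unitary_mat_def mult_four_block_mat[of _ 1 1 _ m _ m _ _ 1 _ m]
          four_block_one_mat[of 1 m, simplified])
    ultimately show ?thesis by (simp add: unitary_mat_def)
  qed
  have "B = four_block_mat ?l (0\<^sub>m 1 m) (0\<^sub>m m 1) B'"
    using B Bsym[of 0] B0 l l' by (intro eq_matI) (auto simp: B'_def)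
  also have "\<dots> = V * real_diag ?n (case_nat (Re l) d) * V\<^sup>\<dagger>"
    unfolding Vad real_diag_Suc unfolding V_def W(2) using Wc
    by (simp add: mult_four_block_mat[of _ 1 1 _ m _ m _ _ 1 _ m] mult_carrier_mat[of _ m m _ m])
  finally have Bd: "B = V * real_diag ?n (case_nat (Re l) d) * V\<^sup>\<dagger>" .
  have Vc: "V \<in> carrier_mat ?n ?n" "V\<^sup>\<dagger> \<in> carrier_mat ?n ?n" using V by (auto simp: unitary_mat_def)
  note [simp] = Vc(1)[THEN carrier_matD(1)] Vc(1)[THEN carrier_matD(2)]
  have "A = (U * U\<^sup>\<dagger>) * A * (U * U\<^sup>\<dagger>)" using UU A by simp
  also have "\<dots> = U * B * U\<^sup>\<dagger>"
    unfolding B_def using c A by (simp add: mult_mat_assoc)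
  also have "\<dots> = (U * V) * real_diag ?n (case_nat (Re l) d) * (U * V)\<^sup>\<dagger>"
    unfolding Bd adjoint_mult[OF c(1) Vc(1)]
    using c Vc by (simp add: mult_mat_assoc)
  finally show ?case using unitary_mult[OF U V] by blast
qed

text \<open>The diagonal entries in the spectral decomposition are values of the quadratic form at the
  columns of \<open>U\<close>, hence nonnegative, and one takes their square roots.\<close>
lemma psd_sqrt:
  assumes A: "A \<in> carrier_mat n n" and psd: "psd_mat A"
  obtains S where "S \<in> carrier_mat n n" "hermitian_mat S" "S * S = A"
proof -
  obtain U d where U: "unitary_mat n U" and Ad: "A = U * real_diag n d * U\<^sup>\<dagger>"
    using spectral_theorem_hermitian[OF A] psd by (auto simp: psd_mat_def)
  have c: "U \<in> carrier_mat n n" "U\<^sup>\<dagger> \<in> carrier_mat n n" and UU: "U\<^sup>\<dagger> * U = 1\<^sub>m n"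
    using U by (auto simp: unitary_mat_def)
  note [simp] = c(1)[THEN carrier_matD(1)] c(1)[THEN carrier_matD(2)] A[THEN carrier_matD(1)] A[THEN carrier_matD(2)]
  have d: "d i \<ge> 0" if i: "i < n" for i
  proof -
    have "U\<^sup>\<dagger> * A * U = (U\<^sup>\<dagger> * U) * real_diag n d * (U\<^sup>\<dagger> * U)"
      unfolding Ad using c by (simp add: mult_mat_assoc)
    also have "\<dots> = real_diag n d" using UU by simp
    finally have D: "U\<^sup>\<dagger> * (A * U) = real_diag n d"
      using c A by (simp add: mult_mat_assoc)
    have "complex_of_real (d i) = (U\<^sup>\<dagger> * (A * U)) $$ (i, i)" unfolding D using i by (simp add: real_diag_def)
    also have "\<dots> = row (U\<^sup>\<dagger>) i \<bullet> col (A * U) i"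
      by (rule index_mult_mat(1)) (use i in simp_all)
    also have "row (U\<^sup>\<dagger>) i = conjugate (col U i)"
      by (rule eq_vecI) (use i in auto)
    also have "col (A * U) i = A *\<^sub>v col U i" by (rule col_mult2[OF A c(1) i])
    also have "conjugate (col U i) \<bullet> (A *\<^sub>v col U i) = (A *\<^sub>v col U i) \<bullet>c col U i"
      by (rule comm_scalar_prod[of _ n]) (auto intro!: carrier_vecI)
    finally have "0 \<le> complex_of_real (d i)" using psd A c i by (auto simp: psd_mat_def)
    then show ?thesis by (simp add: less_eq_complex_def)
  qed
  define S where "S = U * real_diag n (\<lambda>i. sqrt (d i)) * U\<^sup>\<dagger>"
  let ?D = "real_diag n (\<lambda>i. sqrt (d i))"
  have S: "S \<in> carrier_mat n n" using c by (auto simp: S_def)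
  have Sh: "hermitian_mat S"
    unfolding hermitian_mat_def S_def using c
    by (simp add: adjoint_mult_dim real_diag_adjoint mult_mat_assoc)
  have "S * S = U * ?D * (U\<^sup>\<dagger> * U) * ?D * U\<^sup>\<dagger>"
    unfolding S_def using c by (simp add: mult_mat_assoc)
  also have "\<dots> = U * (?D * ?D) * U\<^sup>\<dagger>"
    unfolding UU using c by (simp add: mult_mat_assoc)
  also have "?D * ?D = real_diag n d"
    unfolding real_diag_mult by (rule eq_matI) (use d in \<open>auto simp: real_diag_def simp flip: of_real_mult\<close>)
  finally show thesis using that[OF S Sh] Ad by simp
qed

section \<open>Polar decomposition\<close>

text \<open>If \<open>R\<^sup>* R = U D U\<^sup>*\<close>, then the columns of \<open>Y = R U\<close> are orthogonal and their squared norms are the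
  entries of \<open>D\<close>. Normalising the nonzero ones and completing them to an orthonormal family gives
  an isometry \<open>Q\<close> with \<open>Y = Q \<surd>D\<close>, so that \<open>R R\<^sup>* = Y Y\<^sup>* = Q D Q\<^sup>*\<close> and \<open>V = Q U\<^sup>*\<close> works. The
  completion has room because \<open>p \<le> m\<close>.\<close>
lemma isometry_conjugates_gram:
  assumes R: "R \<in> carrier_mat m p" and pm: "p \<le> m"
  obtains V where "isometry_mat m p V" "R * R\<^sup>\<dagger> = V * (R\<^sup>\<dagger> * R) * V\<^sup>\<dagger>"
proof -
  have Ra: "R\<^sup>\<dagger> \<in> carrier_mat p m" using R by simp
  have G: "R\<^sup>\<dagger> * R \<in> carrier_mat p p" using R by auto
  have "hermitian_mat (R\<^sup>\<dagger> * R)"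
    using R by (simp add: hermitian_mat_def adjoint_mult[OF Ra R])
  then obtain U d where U: "unitary_mat p U" and Gd: "R\<^sup>\<dagger> * R = U * real_diag p d * U\<^sup>\<dagger>"
    using spectral_theorem_hermitian[OF G] by auto
  have c: "U \<in> carrier_mat p p" "U\<^sup>\<dagger> \<in> carrier_mat p p" and UU: "U\<^sup>\<dagger> * U = 1\<^sub>m p" "U * U\<^sup>\<dagger> = 1\<^sub>m p"
    using U by (auto simp: unitary_mat_def)
  note [simp] = c(1)[THEN carrier_matD(1)] c(1)[THEN carrier_matD(2)] R[THEN carrier_matD(1)] R[THEN carrier_matD(2)]
  define Y where "Y = R * U"
  have Y: "Y \<in> carrier_mat m p" "Y\<^sup>\<dagger> \<in> carrier_mat p m" using R c by (auto simp: Y_def)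
  have Yad: "Y\<^sup>\<dagger> = U\<^sup>\<dagger> * R\<^sup>\<dagger>" unfolding Y_def by (rule adjoint_mult[OF R c(1)])
  have "Y\<^sup>\<dagger> * Y = U\<^sup>\<dagger> * (R\<^sup>\<dagger> * R) * U"
    unfolding Yad unfolding Y_def using R Ra c
    by (simp add: mult_mat_assoc)
  also have "\<dots> = (U\<^sup>\<dagger> * U) * real_diag p d * (U\<^sup>\<dagger> * U)"
    unfolding Gd using c by (simp add: mult_mat_assoc)
  finally have YY: "Y\<^sup>\<dagger> * Y = real_diag p d" using UU by simp
  have Yip: "col Y i \<bullet>c col Y j = (if i = j then complex_of_real (d i) else 0)" if "i < p" "j < p" for i j
  proof -
    have "col Y i \<bullet>c col Y j = conjugate (col Y j) \<bullet> col Y i"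
      by (rule comm_scalar_prod[of _ m]) (use Y in auto)
    also have "\<dots> = (Y\<^sup>\<dagger> * Y) $$ (j, i)" using Y that by (simp add: mat_adjoint_def)
    finally show ?thesis unfolding YY using that by (simp add: real_diag_def)
  qed
  have d: "d i \<ge> 0" if "i < p" for i
    using conjugate_square_ge_0_vec[of "col Y i"] Yip[OF that that] by (simp add: less_eq_complex_def)
  define J where "J = {i. i < p \<and> d i \<noteq> 0}"
  define u where "u i = complex_of_real (1 / sqrt (d i)) \<cdot>\<^sub>v col Y i" for i
  have "orthonormal_on m u J"
    unfolding orthonormal_on_def
  proof (intro conjI ballI)
    fix i j assume ij: "i \<in> J" "j \<in> J"
    have "u i \<bullet>c u j = complex_of_real (1 / sqrt (d i) * (1 / sqrt (d j))) * (col Y i \<bullet>c col Y j)"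
      using Y by (simp add: u_def conjugate_smult_vec)
    also have "\<dots> = (if i = j then 1 else 0)"
    proof (cases "i = j")
      case True
      have "1 / sqrt (d j) * (1 / sqrt (d j)) * d j = 1"
        using d[of j] ij by (simp add: J_def)
      then show ?thesis using True ij by (simp add: Yip J_def flip: of_real_mult)
    next
      case False
      then show ?thesis using ij by (simp add: Yip J_def)
    qed
    finally show "u i \<bullet>c u j = (if i = j then 1 else 0)" .
  qed (use Y in \<open>auto simp: u_def\<close>)
  then obtain w where w: "orthonormal_on m w {..<p}" "\<And>i. i \<in> J \<Longrightarrow> w i = u i"
    using orthonormal_extension[of "{..<p}" J m u] pm by (auto simp: J_def)
  define Q where "Q = mat m p (\<lambda>(x, i). w i $ x)"
  have Qiso: "isometry_mat m p Q" unfolding Q_def by (rule isometry_of_orthonormal[OF w(1) pm])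
  have Q: "Q \<in> carrier_mat m p" "Q\<^sup>\<dagger> \<in> carrier_mat p m" by (auto simp: Q_def)
  note [simp] = Q(1)[THEN carrier_matD(1)] Q(1)[THEN carrier_matD(2)]
  let ?D = "real_diag p (\<lambda>i. sqrt (d i))"
  have YQ: "Y = Q * ?D"
  proof (rule eq_matI)
    fix x i assume "x < dim_row (Q * ?D)" "i < dim_col (Q * ?D)"
    then have xi: "x < m" "i < p" using Q by auto
    have "Y $$ (x, i) = w i $ x * complex_of_real (sqrt (d i))"
    proof (cases "d i = 0")
      case True
      then have "col Y i = 0\<^sub>v m"
        using Yip[OF xi(2) xi(2)] conjugate_square_eq_0_vec[of "col Y i" m] Y by auto
      from arg_cong[OF this, of "\<lambda>z. z $ x"] show ?thesis using True xi Y by simp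
    next
      case False
      then have "w i = u i" using w(2) xi by (simp add: J_def)
      then show ?thesis using False xi Y d[of i] by (simp add: u_def)
    qed
    then show "Y $$ (x, i) = (Q * ?D) $$ (x, i)"
      using mult_real_diag_index[OF Q(1) xi] xi by (simp add: Q_def)
  qed (use Y Q in auto)
  have DD: "?D * ?D = real_diag p d"
    unfolding real_diag_mult by (rule eq_matI) (use d in \<open>auto simp: real_diag_def simp flip: of_real_mult\<close>)
  have "R * R\<^sup>\<dagger> = R * (U * U\<^sup>\<dagger>) * R\<^sup>\<dagger>" using UU R by simp
  also have "\<dots> = Y * Y\<^sup>\<dagger>"
    unfolding Yad unfolding Y_def using R Ra c
    by (simp add: mult_mat_assoc)
  also have "\<dots> = Q * (?D * ?D) * Q\<^sup>\<dagger>"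
    unfolding YQ adjoint_mult[OF Q(1) real_diag_carrier] real_diag_adjoint using Q
    by (simp add: mult_mat_assoc)
  also have "\<dots> = Q * ((U\<^sup>\<dagger> * U) * real_diag p d * (U\<^sup>\<dagger> * U)) * Q\<^sup>\<dagger>" unfolding DD UU by simp
  also have "\<dots> = (Q * U\<^sup>\<dagger>) * (U * real_diag p d * U\<^sup>\<dagger>) * (U * Q\<^sup>\<dagger>)" using Q c
    by (simp add: mult_mat_assoc)
  also have "U * Q\<^sup>\<dagger> = (Q * U\<^sup>\<dagger>)\<^sup>\<dagger>" using adjoint_mult[OF Q(1) c(2)] by simp
  finally have "R * R\<^sup>\<dagger> = (Q * U\<^sup>\<dagger>) * (R\<^sup>\<dagger> * R) * (Q * U\<^sup>\<dagger>)\<^sup>\<dagger>" unfolding Gd .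
  moreover have "isometry_mat m p (Q * U\<^sup>\<dagger>)"
  proof -
    have "(Q * U\<^sup>\<dagger>)\<^sup>\<dagger> * (Q * U\<^sup>\<dagger>) = U * (Q\<^sup>\<dagger> * Q) * U\<^sup>\<dagger>"
      using Q c adjoint_mult[OF Q(1) c(2)]
      by (simp add: mult_mat_assoc)
    then show ?thesis using Qiso UU Q c pm by (auto simp: isometry_mat_def)
  qed
  ultimately show thesis using that by blast
qed

section \<open>Block rows with scalar blocks\<close>

lemma sum_blocks: "(\<Sum>x<b * n. f x) = (\<Sum>s<b. \<Sum>i<n. f (s * n + i))" for f :: "nat \<Rightarrow> 'a::comm_monoid_add"
proof -
  have "(\<Sum>x<b * n. f x) = (\<Sum>s<b. sum f {s * n..<s * n + n})"
    by (rule sum.nat_group[symmetric])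
  also have "\<dots> = (\<Sum>s<b. \<Sum>i<n. f (s * n + i))"
  proof (rule sum.cong)
    fix s
    show "sum f {s * n..<s * n + n} = (\<Sum>i<n. f (s * n + i))"
      using sum.shift_bounds_nat_ivl[of f 0 "s * n" n]
      by (simp add: add.commute atLeast0LessThan)
  qed simp
  finally show ?thesis .
qed

lemma block_index_less: "s < b \<Longrightarrow> i < n \<Longrightarrow> s * n + i < b * (n::nat)"
  by (metis (no_types, opaque_lifting) add.commute add_less_cancel_left less_le_trans mult.commute mult_Suc_right mult_le_mono2 Suc_leI)

text \<open>The block row \<open>(c\<^sub>0 I, \<dots>, c\<^sub>b\<^sub>-\<^sub>1 I)\<close> with blocks of size \<open>n\<close>, that is \<open>c \<otimes> I\<close> for the row
  vector \<open>c\<close>.\<close>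
definition block_row :: "nat \<Rightarrow> nat \<Rightarrow> (nat \<Rightarrow> complex) \<Rightarrow> complex mat" where
  "block_row n b c = mat n (b * n) (\<lambda>(i, x). if x mod n = i then c (x div n) else 0)"

lemma block_row_dim [simp]:
  "block_row n b c \<in> carrier_mat n (b * n)"
  "dim_row (block_row n b c) = n" "dim_col (block_row n b c) = b * n"
  by (simp_all add: block_row_def)

lemma block_row_mult_index:
  assumes X: "X \<in> carrier_mat (b * n) m" and i: "i < n" and y: "y < m"
  shows "(block_row n b c * X) $$ (i, y) = (\<Sum>s<b. c s * X $$ (s * n + i, y))"
proof -
  have "(block_row n b c * X) $$ (i, y)
      = (\<Sum>s<b. \<Sum>j<n. block_row n b c $$ (i, s * n + j) * X $$ (s * n + j, y))"
    unfolding mult_mat_index_sum[OF block_row_dim(1) X i y] sum_blocks ..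
  also have "\<dots> = (\<Sum>s<b. \<Sum>j<n. if j = i then c s * X $$ (s * n + i, y) else 0)"
    by (intro sum.cong refl) (use i in \<open>auto simp: block_row_def block_index_less\<close>)
  also have "\<dots> = (\<Sum>s<b. c s * X $$ (s * n + i, y))" using i by simp
  finally show ?thesis .
qed

lemma mult_block_row_adjoint_index:
  assumes X: "X \<in> carrier_mat m (b * n)" and y: "y < m" and j: "j < n"
  shows "(X * (block_row n b d)\<^sup>\<dagger>) $$ (y, j) = (\<Sum>t<b. X $$ (y, t * n + j) * cnj (d t))"
proof -
  have "(X * (block_row n b d)\<^sup>\<dagger>) $$ (y, j) = cnj ((block_row n b d * X\<^sup>\<dagger>) $$ (j, y))"
  proof -
    have "X * (block_row n b d)\<^sup>\<dagger> = (block_row n b d * X\<^sup>\<dagger>)\<^sup>\<dagger>"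
      using X by (subst adjoint_mult_dim) auto
    then show ?thesis using X y j by simp
  qed
  also have "\<dots> = (\<Sum>t<b. X $$ (y, t * n + j) * cnj (d t))"
    unfolding block_row_mult_index[OF adjoint_carrier[OF X] j y]
    using X y j by (simp add: block_index_less mult.commute)
  finally show ?thesis .
qed

lemma block_row_sandwich_index:
  assumes H: "H \<in> carrier_mat (b * n) (b * n)" and ij: "i < n" "j < n"
  shows "(block_row n b c * H * (block_row n b d)\<^sup>\<dagger>) $$ (i, j)
    = (\<Sum>s<b. \<Sum>t<b. c s * cnj (d t) * H $$ (s * n + i, t * n + j))"
proof -
  have "block_row n b c * H \<in> carrier_mat n (b * n)" using H by auto
  from mult_block_row_adjoint_index[OF this ij]
  have "(block_row n b c * H * (block_row n b d)\<^sup>\<dagger>) $$ (i, j)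
      = (\<Sum>t<b. (\<Sum>s<b. c s * H $$ (s * n + i, t * n + j)) * cnj (d t))"
    using ij by (simp add: block_row_mult_index[OF H] block_index_less del: index_mult_mat(1))
  also have "\<dots> = (\<Sum>t<b. \<Sum>s<b. c s * cnj (d t) * H $$ (s * n + i, t * n + j))"
    by (simp add: sum_distrib_left sum_distrib_right mult_ac)
  finally show ?thesis by (subst sum.swap)
qed

lemma block_row_gram_index:
  assumes n: "n > 0" and xy: "x < b * n" "y < b * n"
  shows "((block_row n b c)\<^sup>\<dagger> * block_row n b d) $$ (x, y)
    = (if x mod n = y mod n then cnj (c (x div n)) * d (y div n) else 0)"
proof -
  have "((block_row n b c)\<^sup>\<dagger> * block_row n b d) $$ (x, y)
     = (\<Sum>i<n. ((block_row n b c)\<^sup>\<dagger>) $$ (x, i) * block_row n b d $$ (i, y))"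
    by (rule mult_mat_index_sum[of _ "b * n" n]) (use xy in auto)
  also have "\<dots> = (\<Sum>i<n. if i = x mod n then
       (if x mod n = y mod n then cnj (c (x div n)) * d (y div n) else 0) else 0)"
    by (intro sum.cong refl) (use xy in \<open>auto simp: block_row_def\<close>)
  also have "\<dots> = (if x mod n = y mod n then cnj (c (x div n)) * d (y div n) else 0)"
    using n by simp
  finally show ?thesis .
qed

text \<open>Averaging the sum with its transpose replaces \<open>g\<close> by its symmetric part.\<close>
lemma symmetric_double_sum:
  fixes g A :: "nat \<Rightarrow> nat \<Rightarrow> complex"
  assumes sym: "\<And>s t. s < b \<Longrightarrow> t < b \<Longrightarrow> A s t = A t s"
    and g: "\<And>s t. s < b \<Longrightarrow> t < b \<Longrightarrow> g s t + g t s = (if s = t then 2 * \<gamma> else 0)"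
  shows "(\<Sum>s<b. \<Sum>t<b. g s t * A s t) = \<gamma> * (\<Sum>s<b. A s s)"
proof -
  let ?S = "\<Sum>s<b. \<Sum>t<b. g s t * A s t"
  have "?S = (\<Sum>s<b. \<Sum>t<b. g t s * A t s)" by (rule sum.swap)
  also have "\<dots> = (\<Sum>s<b. \<Sum>t<b. g t s * A s t)"
    by (intro sum.cong refl) (use sym in auto)
  finally have "2 * ?S = (\<Sum>s<b. \<Sum>t<b. (g s t + g t s) * A s t)"
    by (simp add: sum.distrib distrib_right)
  also have "\<dots> = (\<Sum>s<b. \<Sum>t<b. if s = t then 2 * \<gamma> * A s s else 0)"
    by (intro sum.cong refl) (auto simp: g)
  also have "\<dots> = 2 * (\<gamma> * (\<Sum>s<b. A s s))" by (simp add: sum_distrib_left mult_ac)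
  finally show ?thesis by simp
qed

lemma direct_sum_mat_four_block:
  assumes "A \<in> carrier_mat n m" "B \<in> carrier_mat p q"
  shows "A \<oplus>\<^sub>m B = four_block_mat A (0\<^sub>m n q) (0\<^sub>m p m) B"
proof -
  have "four_block_mat B (0\<^sub>m (dim_row B) 0) (0\<^sub>m 0 (dim_col B)) (0\<^sub>m 0 0) = B"
    by (rule eq_matI) auto
  then show ?thesis using assms by (simp add: Let_def)
qed

section \<open>Block rows of quaternions\<close>

text \<open>The complex pair \<open>(p, q)\<close> stands for the quaternion with matrix
  \<open>[[p, q], [- cnj q, cnj p]]\<close>. This is the block row of the matrices \<open>u\<^sub>s \<otimes> I\<close>, where \<open>u\<^sub>s\<close> is the
  quaternion \<open>(p s, q s)\<close>, after the permutation of the columns that suits \<open>H \<oplus> H\<close>: the index of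
  the \<open>2 \<times> 2\<close> matrices is the outermost one.\<close>
definition quaternion_row :: "nat \<Rightarrow> nat \<Rightarrow> (nat \<Rightarrow> complex) \<Rightarrow> (nat \<Rightarrow> complex) \<Rightarrow> complex mat" where
  "quaternion_row n b p q = four_block_mat
     (block_row n b p) (block_row n b q)
     (block_row n b (\<lambda>s. - cnj (q s))) (block_row n b (\<lambda>s. cnj (p s)))"

lemma quaternion_row_carrier: "quaternion_row n b p q \<in> carrier_mat (n + n) (b * n + b * n)"
  unfolding quaternion_row_def by (intro four_block_carrier_mat) simp_all

lemma quaternion_row_adjoint:
  "(quaternion_row n b p q)\<^sup>\<dagger> = four_block_mat
     ((block_row n b p)\<^sup>\<dagger>) ((block_row n b (\<lambda>s. - cnj (q s)))\<^sup>\<dagger>)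
     ((block_row n b q)\<^sup>\<dagger>) ((block_row n b (\<lambda>s. cnj (p s)))\<^sup>\<dagger>)"
  unfolding quaternion_row_def
  by (rule adjoint_four_block[of _ n "b * n" _ "b * n" _ n]) simp_all

text \<open>Each of the four \<open>n \<times> n\<close> blocks of the product is a sum \<open>\<Sum> g(s,t) A\<^sub>s\<^sub>t\<close>, where \<open>g(s,t)\<close> is the
  corresponding entry of \<open>u\<^sub>s u\<^sub>t\<^sup>*\<close>. The diagonal entries have symmetric part \<open>\<gamma> \<delta>\<^sub>s\<^sub>t\<close> by hypothesis
  \<open>orth\<close>; the off-diagonal ones, such as \<open>q s * p t - p s * q t\<close>, are antisymmetric for any
  quaternions.\<close>
lemma quaternion_row_compression:
  assumes H: "H \<in> carrier_mat (b * n) (b * n)"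
    and sym: "\<And>s t i j. s < b \<Longrightarrow> t < b \<Longrightarrow> i < n \<Longrightarrow> j < n \<Longrightarrow>
       H $$ (s * n + i, t * n + j) = H $$ (t * n + i, s * n + j)"
    and orth: "\<And>s t. s < b \<Longrightarrow> t < b \<Longrightarrow>
       (p s * cnj (p t) + q s * cnj (q t)) + (p t * cnj (p s) + q t * cnj (q s)) = (if s = t then 2 * \<gamma> else 0)"
    and D: "D = mat_sum n n (\<lambda>s. block n H s s) {..<b}"
  shows "quaternion_row n b p q * (H \<oplus>\<^sub>m H) * (quaternion_row n b p q)\<^sup>\<dagger> = \<gamma> \<cdot>\<^sub>m (D \<oplus>\<^sub>m D)"
proof -
  let ?R = "block_row n b"
  let ?q' = "\<lambda>s. - cnj (q s)" and ?p' = "\<lambda>s. cnj (p s)"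
  have Dc: "D \<in> carrier_mat n n" by (simp add: D mat_sum_def)
  have RH: "?R c * H \<in> carrier_mat n (b * n)" for c using H by auto
  have RHR: "?R c * H * (?R d)\<^sup>\<dagger> \<in> carrier_mat n n" for c d
    by (intro mult_carrier_mat[OF RH] adjoint_carrier) simp
  have blk: "?R c * H * (?R d)\<^sup>\<dagger> + ?R c' * H * (?R d')\<^sup>\<dagger> = e \<cdot>\<^sub>m D"
    if "\<And>s t. s < b \<Longrightarrow> t < b \<Longrightarrow> (c s * cnj (d t) + c' s * cnj (d' t)) + (c t * cnj (d s) + c' t * cnj (d' s))
        = (if s = t then 2 * e else 0)" for c d c' d' e
  proof (rule eq_matI)
    fix i j assume "i < dim_row (e \<cdot>\<^sub>m D)" "j < dim_col (e \<cdot>\<^sub>m D)"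
    then have ij: "i < n" "j < n" using Dc by auto
    have "(?R c * H * (?R d)\<^sup>\<dagger> + ?R c' * H * (?R d')\<^sup>\<dagger>) $$ (i, j)
       = (\<Sum>s<b. \<Sum>t<b. (c s * cnj (d t) + c' s * cnj (d' t)) * H $$ (s * n + i, t * n + j))"
      using ij H carrier_matD[OF RHR] by (simp add: block_row_sandwich_index[OF H] sum.distrib distrib_right
         del: index_mult_mat(1))
    also have "\<dots> = e * (\<Sum>s<b. H $$ (s * n + i, s * n + j))"
      by (rule symmetric_double_sum) (use ij sym that in auto)
    also have "\<dots> = (e \<cdot>\<^sub>m D) $$ (i, j)" using ij by (simp add: D mat_sum_def block_def)
    finally show "(?R c * H * (?R d)\<^sup>\<dagger> + ?R c' * H * (?R d')\<^sup>\<dagger>) $$ (i, j) = (e \<cdot>\<^sub>m D) $$ (i, j)" .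
  qed (use Dc H in auto)
  have "quaternion_row n b p q * (H \<oplus>\<^sub>m H) = four_block_mat
     (?R p * H) (?R q * H) (?R ?q' * H) (?R ?p' * H)"
    unfolding quaternion_row_def direct_sum_mat_four_block[OF H H]
    using H by (subst mult_four_block_mat[of _ n "b * n" _ "b * n" _ n _ _ "b * n" _ "b * n"]) auto
  then have "quaternion_row n b p q * (H \<oplus>\<^sub>m H) * (quaternion_row n b p q)\<^sup>\<dagger>
     = four_block_mat (?R p * H) (?R q * H) (?R ?q' * H) (?R ?p' * H) * (quaternion_row n b p q)\<^sup>\<dagger>"
    by simp
  also have "\<dots> = four_block_mat
     (?R p * H * (?R p)\<^sup>\<dagger> + ?R q * H * (?R q)\<^sup>\<dagger>) (?R p * H * (?R ?q')\<^sup>\<dagger> + ?R q * H * (?R ?p')\<^sup>\<dagger>)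
     (?R ?q' * H * (?R p)\<^sup>\<dagger> + ?R ?p' * H * (?R q)\<^sup>\<dagger>) (?R ?q' * H * (?R ?q')\<^sup>\<dagger> + ?R ?p' * H * (?R ?p')\<^sup>\<dagger>)"
    unfolding quaternion_row_adjoint
    by (rule mult_four_block_mat[of _ n "b * n" _ "b * n" _ n _ _ n _ n]) (simp_all add: RH)
  also have "\<dots> = four_block_mat (\<gamma> \<cdot>\<^sub>m D) (0 \<cdot>\<^sub>m D) (0 \<cdot>\<^sub>m D) (\<gamma> \<cdot>\<^sub>m D)"
    by (intro cong_four_block_mat blk) (use orth in \<open>auto simp: mult.commute add_ac\<close>)
  also have "\<dots> = \<gamma> \<cdot>\<^sub>m (D \<oplus>\<^sub>m D)"
    unfolding direct_sum_mat_four_block[OF Dc Dc] using Dc by (intro eq_matI) auto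
  finally show ?thesis .
qed

text \<open>The blocks of \<open>\<Sum> Z\<^sub>k\<^sup>* Z\<^sub>k\<close> in position \<open>(s, t)\<close> carry the factor \<open>\<Sum>\<^sub>k h k s * h k t\<close>, which
  vanishes for \<open>s \<noteq> t\<close>; for \<open>s = t\<close> what remains is \<open>u\<^sub>s\<^sup>* u\<^sub>s = 1\<close>.\<close>
lemma quaternion_row_resolution:
  fixes h :: "'k \<Rightarrow> nat \<Rightarrow> real" and p q :: "nat \<Rightarrow> complex"
  assumes n: "n > 0"
    and h: "\<And>s t. s < b \<Longrightarrow> t < b \<Longrightarrow> (\<Sum>k\<in>K. h k s * h k t) = (if s = t then 1 else 0)"
    and unit: "\<And>s. s < b \<Longrightarrow> p s * cnj (p s) + q s * cnj (q s) = 1"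
  shows "mat_sum (b * n + b * n) (b * n + b * n)
     (\<lambda>k. (quaternion_row n b (\<lambda>s. of_real (h k s) * p s) (\<lambda>s. of_real (h k s) * q s))\<^sup>\<dagger>
        * quaternion_row n b (\<lambda>s. of_real (h k s) * p s) (\<lambda>s. of_real (h k s) * q s)) K
     = 1\<^sub>m (b * n + b * n)" (is "mat_sum ?N ?N (\<lambda>k. (?Z k)\<^sup>\<dagger> * ?Z k) K = _")
proof (rule eq_matI)
  let ?R = "block_row n b"
  let ?p = "\<lambda>k s. complex_of_real (h k s) * p s" and ?q = "\<lambda>k s. complex_of_real (h k s) * q s"
  fix x y assume "x < dim_row (1\<^sub>m ?N :: complex mat)" "y < dim_col (1\<^sub>m ?N :: complex mat)"
  then have xy: "x < ?N" "y < ?N" by auto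
  have hh: "(\<Sum>k\<in>K. complex_of_real (h k s) * complex_of_real (h k t)) = (if s = t then 1 else 0)"
    if "s < b" "t < b" for s t
    using arg_cong[OF h[OF that], of complex_of_real] by (auto split: if_splits)
  have pull: "(\<Sum>k\<in>K. complex_of_real (h k s) * complex_of_real (h k t) * w) = (if s = t then w else 0)"
    if "s < b" "t < b" for s t w
    using hh[OF that] by (simp flip: sum_distrib_right)
  have dv: "z div n < b" if "z < b * n" for z
    using that by (simp add: less_mult_imp_div_less)
  have eq: "z = z'" if "z mod n = z' mod n" "z div n = z' div n" for z z'
    using that by (metis div_mult_mod_eq)
  \<comment> \<open>The positions of \<open>x\<close> and \<open>y\<close> within their copy of the \<open>b * n\<close> indices; \<open>w\<close> below is the
     entry of \<open>u\<^sub>s\<^sup>* u\<^sub>t\<close> that belongs to these copies.\<close>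
  define x' where "x' = (if x < b * n then x else x - b * n)"
  define y' where "y' = (if y < b * n then y else y - b * n)"
  have x': "x' < b * n" and y': "y' < b * n" using xy by (auto simp: x'_def y'_def)
  let ?s = "x' div n" and ?t = "y' div n"
  define w where "w p q = (if x < b * n then
        if y < b * n then cnj (p ?s) * p ?t + q ?s * cnj (q ?t) else cnj (p ?s) * q ?t - q ?s * cnj (p ?t)
      else if y < b * n then cnj (q ?s) * p ?t - p ?s * cnj (q ?t) else cnj (q ?s) * q ?t + p ?s * cnj (p ?t))"
    for p q :: "nat \<Rightarrow> complex"
  have gram: "((quaternion_row n b p q)\<^sup>\<dagger> * quaternion_row n b p q) $$ (x, y)
     = (if x' mod n = y' mod n then w p q else 0)" for p q
  proof -
    let ?q' = "\<lambda>s. - cnj (q s)" and ?p' = "\<lambda>s. cnj (p s)"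
    have ZZ: "(quaternion_row n b p q)\<^sup>\<dagger> * quaternion_row n b p q = four_block_mat
       ((?R p)\<^sup>\<dagger> * ?R p + (?R ?q')\<^sup>\<dagger> * ?R ?q') ((?R p)\<^sup>\<dagger> * ?R q + (?R ?q')\<^sup>\<dagger> * ?R ?p')
       ((?R q)\<^sup>\<dagger> * ?R p + (?R ?p')\<^sup>\<dagger> * ?R ?q') ((?R q)\<^sup>\<dagger> * ?R q + (?R ?p')\<^sup>\<dagger> * ?R ?p')"
      unfolding quaternion_row_adjoint unfolding quaternion_row_def
      by (rule mult_four_block_mat[of _ "b * n" n _ n _ "b * n" _ _ "b * n" _ "b * n"]) simp_all
    have blk: "((?R c)\<^sup>\<dagger> * ?R d + (?R c')\<^sup>\<dagger> * ?R d') $$ (x', y')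
        = (if x' mod n = y' mod n then cnj (c ?s) * d ?t + cnj (c' ?s) * d' ?t else 0)" for c d c' d'
      using x' y' by (simp add: block_row_gram_index[OF n] del: index_mult_mat(1))
    have "((quaternion_row n b p q)\<^sup>\<dagger> * quaternion_row n b p q) $$ (x, y) =
      (if x < b * n then
         if y < b * n then ((?R p)\<^sup>\<dagger> * ?R p + (?R ?q')\<^sup>\<dagger> * ?R ?q') $$ (x', y')
         else ((?R p)\<^sup>\<dagger> * ?R q + (?R ?q')\<^sup>\<dagger> * ?R ?p') $$ (x', y')
       else if y < b * n then ((?R q)\<^sup>\<dagger> * ?R p + (?R ?p')\<^sup>\<dagger> * ?R ?q') $$ (x', y')
         else ((?R q)\<^sup>\<dagger> * ?R q + (?R ?p')\<^sup>\<dagger> * ?R ?p') $$ (x', y'))"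
      unfolding ZZ using xy by (subst index_mat_four_block) (simp_all add: x'_def y'_def del: index_add_mat(1) index_mult_mat(1))
    then show ?thesis unfolding blk by (simp add: w_def)
  qed
  have "w (?p k) (?q k) = complex_of_real (h k ?s) * complex_of_real (h k ?t) * w p q" for k
    by (simp add: w_def algebra_simps)
  then have entry: "((?Z k)\<^sup>\<dagger> * ?Z k) $$ (x, y)
     = complex_of_real (h k ?s) * complex_of_real (h k ?t) * (if x' mod n = y' mod n then w p q else 0)" for k
    unfolding gram by simp
  have "mat_sum ?N ?N (\<lambda>k. (?Z k)\<^sup>\<dagger> * ?Z k) K $$ (x, y)
      = (if ?s = ?t then if x' mod n = y' mod n then w p q else 0 else 0)"
    using xy pull[OF dv[OF x'] dv[OF y']] by (simp add: mat_sum_def entry del: index_mult_mat(1))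
  also have "\<dots> = 1\<^sub>m ?N $$ (x, y)"
  proof (cases "x' = y'")
    case True
    then show ?thesis using xy unit[OF dv[OF y']]
      by (auto simp: w_def x'_def y'_def algebra_simps split: if_splits)
  next
    case False
    then have "x \<noteq> y" by (auto simp: x'_def y'_def)
    then show ?thesis using False eq[of x' y'] xy by auto
  qed
  finally show "mat_sum ?N ?N (\<lambda>k. (?Z k)\<^sup>\<dagger> * ?Z k) K $$ (x, y) = 1\<^sub>m ?N $$ (x, y)" .
qed (auto simp: mat_sum_def)

section \<open>Decompositions into isometric conjugates\<close>

lemma mat_sum_cong: "(\<And>k. k \<in> K \<Longrightarrow> f k = g k) \<Longrightarrow> mat_sum n m f K = mat_sum n m g K"
  by (simp add: mat_sum_def)

lemma mat_sum_mult_left: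
  fixes A :: "'a::comm_semiring_0 mat"
  assumes A: "A \<in> carrier_mat n m" and f: "\<And>k. k \<in> K \<Longrightarrow> f k \<in> carrier_mat m p"
  shows "A * mat_sum m p f K = mat_sum n p (\<lambda>k. A * f k) K"
proof (rule eq_matI)
  fix i j assume "i < dim_row (mat_sum n p (\<lambda>k. A * f k) K)" "j < dim_col (mat_sum n p (\<lambda>k. A * f k) K)"
  then have ij: "i < n" "j < p" by (auto simp: mat_sum_def)
  have "(A * mat_sum m p f K) $$ (i, j) = (\<Sum>x<m. \<Sum>k\<in>K. A $$ (i, x) * f k $$ (x, j))"
    using mult_mat_index_sum[OF A _ ij, of "mat_sum m p f K"] ij by (simp add: mat_sum_def sum_distrib_left)
  also have "\<dots> = (\<Sum>k\<in>K. \<Sum>x<m. A $$ (i, x) * f k $$ (x, j))" by (rule sum.swap)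
  also have "\<dots> = (\<Sum>k\<in>K. (A * f k) $$ (i, j))"
    by (rule sum.cong) (simp_all add: mult_mat_index_sum[OF A f ij] del: index_mult_mat(1))
  finally show "(A * mat_sum m p f K) $$ (i, j) = mat_sum n p (\<lambda>k. A * f k) K $$ (i, j)"
    using ij by (simp add: mat_sum_def)
qed (use A in \<open>auto simp: mat_sum_def\<close>)

lemma mat_sum_mult_right:
  fixes A :: "'a::comm_semiring_0 mat"
  assumes A: "A \<in> carrier_mat m p" and f: "\<And>k. k \<in> K \<Longrightarrow> f k \<in> carrier_mat n m"
  shows "mat_sum n m f K * A = mat_sum n p (\<lambda>k. f k * A) K"
proof (rule eq_matI)
  fix i j assume "i < dim_row (mat_sum n p (\<lambda>k. f k * A) K)" "j < dim_col (mat_sum n p (\<lambda>k. f k * A) K)"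
  then have ij: "i < n" "j < p" by (auto simp: mat_sum_def)
  have "(mat_sum n m f K * A) $$ (i, j) = (\<Sum>x<m. \<Sum>k\<in>K. f k $$ (i, x) * A $$ (x, j))"
    using mult_mat_index_sum[OF _ A ij, of "mat_sum n m f K"] ij by (simp add: mat_sum_def sum_distrib_right)
  also have "\<dots> = (\<Sum>k\<in>K. \<Sum>x<m. f k $$ (i, x) * A $$ (x, j))" by (rule sum.swap)
  also have "\<dots> = (\<Sum>k\<in>K. (f k * A) $$ (i, j))"
    by (rule sum.cong) (simp_all add: mult_mat_index_sum[OF f A ij] del: index_mult_mat(1))
  finally show "(mat_sum n m f K * A) $$ (i, j) = mat_sum n p (\<lambda>k. f k * A) K $$ (i, j)"
    using ij by (simp add: mat_sum_def)
qed (use A in \<open>auto simp: mat_sum_def\<close>)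

text \<open>A resolution of the identity into terms \<open>Z\<^sub>k\<^sup>* Z\<^sub>k\<close>, all of which compress \<open>T\<^sup>2\<close> to the same
  matrix \<open>G\<close>, turns into a decomposition of \<open>T\<^sup>2\<close>: insert it between the two factors \<open>T\<close> and exchange
  the factors of each term \<open>(T Z\<^sub>k\<^sup>*) (T Z\<^sub>k\<^sup>*)\<^sup>*\<close> by polar decomposition.\<close>
lemma isometric_decomposition:
  assumes T: "T \<in> carrier_mat N N" "hermitian_mat T" and r: "r \<le> N"
    and Z: "\<And>k. k \<in> K \<Longrightarrow> Z k \<in> carrier_mat r N"
    and res: "mat_sum N N (\<lambda>k. (Z k)\<^sup>\<dagger> * Z k) K = 1\<^sub>m N"
    and comp: "\<And>k. k \<in> K \<Longrightarrow> Z k * (T * T) * (Z k)\<^sup>\<dagger> = G"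
  obtains V where "\<And>k. k \<in> K \<Longrightarrow> isometry_mat N r (V k)"
    "T * T = mat_sum N N (\<lambda>k. V k * G * (V k)\<^sup>\<dagger>) K"
proof -
  have Th: "T\<^sup>\<dagger> = T" using T by (simp add: hermitian_mat_def)
  note [simp] = carrier_matD[OF T(1)]
  have "\<exists>V. isometry_mat N r V \<and> T * ((Z k)\<^sup>\<dagger> * Z k) * T = V * G * V\<^sup>\<dagger>" if k: "k \<in> K" for k
  proof -
    note [simp] = carrier_matD[OF Z[OF k]]
    let ?R = "T * (Z k)\<^sup>\<dagger>"
    have R: "?R \<in> carrier_mat N r" using T Z[OF k] by (intro carrier_matI) auto
    have Ra: "?R\<^sup>\<dagger> = Z k * T" by (simp add: adjoint_mult_dim Th)
    obtain V where "isometry_mat N r V" "?R * ?R\<^sup>\<dagger> = V * (?R\<^sup>\<dagger> * ?R) * V\<^sup>\<dagger>"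
      using isometry_conjugates_gram[OF R r] .
    moreover have "?R\<^sup>\<dagger> * ?R = G"
      unfolding Ra comp[OF k, symmetric] by (simp add: mult_mat_assoc)
    moreover have "?R * ?R\<^sup>\<dagger> = T * ((Z k)\<^sup>\<dagger> * Z k) * T"
      unfolding Ra by (simp add: mult_mat_assoc)
    ultimately show ?thesis by auto
  qed
  then obtain V where V: "\<And>k. k \<in> K \<Longrightarrow> isometry_mat N r (V k)"
    "\<And>k. k \<in> K \<Longrightarrow> T * ((Z k)\<^sup>\<dagger> * Z k) * T = V k * G * (V k)\<^sup>\<dagger>"
    by metis
  have ZZ: "(Z k)\<^sup>\<dagger> * Z k \<in> carrier_mat N N" if "k \<in> K" for k
    using Z[OF that] by auto
  have "T * T = T * mat_sum N N (\<lambda>k. (Z k)\<^sup>\<dagger> * Z k) K * T" using T by (simp add: res)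
  also have "\<dots> = mat_sum N N (\<lambda>k. T * ((Z k)\<^sup>\<dagger> * Z k) * T) K"
    using mat_sum_mult_left[OF T(1) ZZ, of K] mat_sum_mult_right[OF T(1) mult_carrier_mat[OF T(1) ZZ], of K] by simp
  also have "\<dots> = mat_sum N N (\<lambda>k. V k * G * (V k)\<^sup>\<dagger>) K"
    by (rule mat_sum_cong) (rule V(2))
  finally show thesis using that V(1) by blast
qed

lemma mat_sum_smult:
  fixes c :: "'a::comm_semiring_0"
  assumes f: "\<And>k. k \<in> K \<Longrightarrow> f k \<in> carrier_mat n m"
  shows "mat_sum n m (\<lambda>k. c \<cdot>\<^sub>m f k) K = c \<cdot>\<^sub>m mat_sum n m f K"
proof -
  have "(c \<cdot>\<^sub>m f k) $$ (i, j) = c * f k $$ (i, j)" if "k \<in> K" "i < n" "j < m" for k i j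
    using carrier_matD[OF f[OF that(1)]] that by simp
  then show ?thesis by (intro eq_matI) (auto simp: mat_sum_def sum_distrib_left intro!: sum.cong)
qed

section \<open>Four quaternion units and four sign patterns\<close>

text \<open>The block \<open>A\<^sub>s\<^sub>t\<close> is Hermitian and, as \<open>H\<close> is Hermitian, its adjoint is \<open>A\<^sub>t\<^sub>s\<close>.\<close>
lemma hermitian_blocks_symmetric:
  assumes "H \<in> carrier_mat (b * n) (b * n)" "hermitian_mat H"
    and blk: "\<And>s t. s < b \<Longrightarrow> t < b \<Longrightarrow> hermitian_mat (block n H s t)"
    and st: "s < b" "t < b" and ij: "i < n" "j < n"
  shows "H $$ (s * n + i, t * n + j) = H $$ (t * n + i, s * n + j)"
proof -
  have "H $$ (s * n + i, t * n + j) = cnj (H $$ (t * n + j, s * n + i))"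
    using adjoint_index[of "s * n + i" H "t * n + j"] assms(1,2) st ij
    by (metis block_index_less carrier_matD conjugate_complex_def hermitian_mat_def)
  also have "H $$ (t * n + j, s * n + i) = block n H t s $$ (j, i)" using ij by (simp add: block_def)
  also have "\<dots> = (block n H t s)\<^sup>\<dagger> $$ (j, i)"
    using blk[OF st(2,1)] by (simp add: hermitian_mat_def)
  also have "\<dots> = cnj (block n H t s $$ (i, j))" using ij by (simp add: block_def)
  also have "cnj \<dots> = H $$ (t * n + i, s * n + j)" using ij by (simp add: block_def)
  finally show ?thesis .
qed

text \<open>The pairs \<open>(p, q)\<close> that represent the units \<open>1, i, j, k\<close>.\<close>
definition quaternion_unit_fst :: "nat \<Rightarrow> complex" where
  "quaternion_unit_fst s = [1, \<i>, 0, 0] ! s"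

definition quaternion_unit_snd :: "nat \<Rightarrow> complex" where
  "quaternion_unit_snd s = [0, 0, 1, \<i>] ! s"

text \<open>The left-hand side is twice the Euclidean inner product of two units in \<open>\<real>\<^sup>4\<close>.\<close>
lemma quaternion_units_orthonormal:
  assumes "s < 4" "t < 4"
  shows "quaternion_unit_fst s * cnj (quaternion_unit_fst t) + quaternion_unit_snd s * cnj (quaternion_unit_snd t)
       + (quaternion_unit_fst t * cnj (quaternion_unit_fst s) + quaternion_unit_snd t * cnj (quaternion_unit_snd s))
     = (if s = t then 2 else 0)"
  using assms by (auto simp: less_Suc_eq numeral_eq_Suc quaternion_unit_fst_def quaternion_unit_snd_def)

text \<open>The \<open>4 \<times> 4\<close> Hadamard matrix with rows \<open>++++\<close>, \<open>+-+-\<close>, \<open>++--\<close>, \<open>+--+\<close>, scaled to be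
  orthogonal. Rows are counted from 1, like the isometries; columns from 0, like the blocks.\<close>
definition half_hadamard :: "nat \<Rightarrow> nat \<Rightarrow> real" where
  "half_hadamard k s = (if (k, s) \<in> {(2, 1), (2, 3), (3, 2), (3, 3), (4, 1), (4, 2)} then - 1 / 2 else 1 / 2)"

lemma half_hadamard_orthonormal:
  assumes "s < 4" "t < 4"
  shows "(\<Sum>k\<in>{1..4}. half_hadamard k s * half_hadamard k t) = (if s = t then 1 else 0)"
proof -
  have K: "{1..4::nat} = {1, 2, 3, 4}" by auto
  have "s = 0 \<or> s = 1 \<or> s = 2 \<or> s = 3" "t = 0 \<or> t = 1 \<or> t = 2 \<or> t = 3" using assms by auto
  then show ?thesis unfolding K by (elim disjE) (simp_all add: half_hadamard_def)
qed

theorem theorem3p1: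
  fixes \<beta> n :: nat and H \<Delta> :: "complex mat"
  assumes "\<beta> \<in> {3, 4}"
    and "n \<ge> 1"
    and "H \<in> carrier_mat (\<beta> * n) (\<beta> * n)"
    and "psd_mat H"
    and "\<And>s t. s < \<beta> \<Longrightarrow> t < \<beta> \<Longrightarrow> hermitian_mat (block n H s t)"
    and "\<Delta> = mat_sum n n (\<lambda>s. block n H s s) {..<\<beta>}"
  shows "\<exists>V :: nat \<Rightarrow> complex mat.
           (\<forall>k\<in>{1..4}. isometry_mat (2 * \<beta> * n) (2 * n) (V k)) \<and>
           H \<oplus>\<^sub>m H =
             (1 / 4) \<cdot>\<^sub>m mat_sum (2 * \<beta> * n) (2 * \<beta> * n)
                        (\<lambda>k. V k * (\<Delta> \<oplus>\<^sub>m \<Delta>) * mat_adjoint (V k)) {1..4}"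
proof -
  note H = assms(3)
  let ?N = "\<beta> * n + \<beta> * n"
  let ?p = quaternion_unit_fst and ?q = quaternion_unit_snd
  have \<beta>: "\<beta> \<le> 4" using assms(1) by auto
  have Hh: "hermitian_mat H" using assms(4) by (simp add: psd_mat_def)
  obtain S where S: "S \<in> carrier_mat (\<beta> * n) (\<beta> * n)" "hermitian_mat S" "S * S = H"
    using psd_sqrt[OF H assms(4)] .
  define T where "T = four_block_mat S (0\<^sub>m (\<beta> * n) (\<beta> * n)) (0\<^sub>m (\<beta> * n) (\<beta> * n)) S"
  have T: "T \<in> carrier_mat ?N ?N" unfolding T_def using S(1) by (intro four_block_carrier_mat)
  have Th: "hermitian_mat T"
    unfolding hermitian_mat_def T_def using S by (subst adjoint_four_block) (auto simp: adjoint_zero hermitian_mat_def)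
  have TT: "T * T = H \<oplus>\<^sub>m H"
    unfolding direct_sum_mat_four_block[OF H H] T_def using S H
    by (subst mult_four_block_mat[of _ "\<beta> * n" "\<beta> * n" _ "\<beta> * n" _ "\<beta> * n" _ _ "\<beta> * n" _ "\<beta> * n"]) auto
  define Z where "Z k = quaternion_row n \<beta> (\<lambda>s. of_real (half_hadamard k s) * ?p s)
     (\<lambda>s. of_real (half_hadamard k s) * ?q s)" for k
  have Z: "Z k \<in> carrier_mat (n + n) ?N" for k
    unfolding Z_def by (rule quaternion_row_carrier)
  have half: "x = 1" if "x + x = 2" for x :: complex
    using that by (auto simp: complex_eq_iff)
  have res: "mat_sum ?N ?N (\<lambda>k. (Z k)\<^sup>\<dagger> * Z k) {1..4} = 1\<^sub>m ?N"
    unfolding Z_def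
  proof (rule quaternion_row_resolution)
    fix s assume "s < \<beta>"
    then show "?p s * cnj (?p s) + ?q s * cnj (?q s) = 1"
      by (intro half) (use quaternion_units_orthonormal[of s s] \<beta> in simp)
  qed (use assms(2) \<beta> half_hadamard_orthonormal in auto)
  have comp: "Z k * (T * T) * (Z k)\<^sup>\<dagger> = (1 / 4) \<cdot>\<^sub>m (\<Delta> \<oplus>\<^sub>m \<Delta>)" for k
    unfolding Z_def TT
  proof (rule quaternion_row_compression[OF H _ _ assms(6)])
    fix s t assume st: "s < \<beta>" "t < \<beta>"
    let ?h = "\<lambda>s. complex_of_real (half_hadamard k s)"
    have "?h s * ?p s * cnj (?h t * ?p t) + ?h s * ?q s * cnj (?h t * ?q t)
       + (?h t * ?p t * cnj (?h s * ?p s) + ?h t * ?q t * cnj (?h s * ?q s))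
     = ?h s * ?h t * (?p s * cnj (?p t) + ?q s * cnj (?q t)
       + (?p t * cnj (?p s) + ?q t * cnj (?q s)))"
      by (simp add: algebra_simps)
    also have "\<dots> = ?h s * ?h t * (if s = t then 2 else 0)"
      using quaternion_units_orthonormal[of s t] st \<beta> by simp
    also have "\<dots> = (if s = t then 2 * (1 / 4) else 0)" by (auto simp: half_hadamard_def)
    finally show "?h s * ?p s * cnj (?h t * ?p t) + ?h s * ?q s * cnj (?h t * ?q t)
       + (?h t * ?p t * cnj (?h s * ?p s) + ?h t * ?q t * cnj (?h s * ?q s))
     = (if s = t then 2 * (1 / 4) else 0)" .
  qed (rule hermitian_blocks_symmetric[OF H Hh assms(5)])
  have nN: "n + n \<le> ?N" using assms(1) by auto
  obtain V where V: "\<And>k. k \<in> {1..4::nat} \<Longrightarrow> isometry_mat ?N (n + n) (V k)"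
    and dec: "T * T = mat_sum ?N ?N (\<lambda>k. V k * ((1 / 4) \<cdot>\<^sub>m (\<Delta> \<oplus>\<^sub>m \<Delta>)) * (V k)\<^sup>\<dagger>) {1..4}"
    by (rule isometric_decomposition[where Z = Z and K = "{1..4}", OF T Th nN Z res comp], rule that)
      blast+
  have \<Delta>: "\<Delta> \<in> carrier_mat n n" by (simp add: assms(6) mat_sum_def)
  have \<Delta>\<Delta>: "\<Delta> \<oplus>\<^sub>m \<Delta> \<in> carrier_mat (n + n) (n + n)"
    unfolding direct_sum_mat_four_block[OF \<Delta> \<Delta>] using \<Delta> by (intro four_block_carrier_mat)
  have Vc: "V k \<in> carrier_mat ?N (n + n)" if "k \<in> {1..4}" for k
    using V[OF that] by (simp add: isometry_mat_def)
  have Vk: "V k * ((1 / 4) \<cdot>\<^sub>m (\<Delta> \<oplus>\<^sub>m \<Delta>)) * (V k)\<^sup>\<dagger> = (1 / 4) \<cdot>\<^sub>m (V k * (\<Delta> \<oplus>\<^sub>m \<Delta>) * (V k)\<^sup>\<dagger>)"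
    and Vkc: "V k * (\<Delta> \<oplus>\<^sub>m \<Delta>) * (V k)\<^sup>\<dagger> \<in> carrier_mat ?N ?N" if "k \<in> {1..4}" for k
  proof -
    have VD: "V k * (\<Delta> \<oplus>\<^sub>m \<Delta>) \<in> carrier_mat ?N (n + n)"
      by (rule mult_carrier_mat[OF Vc[OF that] \<Delta>\<Delta>])
    then show "V k * (\<Delta> \<oplus>\<^sub>m \<Delta>) * (V k)\<^sup>\<dagger> \<in> carrier_mat ?N ?N"
      by (rule mult_carrier_mat) (rule adjoint_carrier[OF Vc[OF that]])
    show "V k * ((1 / 4) \<cdot>\<^sub>m (\<Delta> \<oplus>\<^sub>m \<Delta>)) * (V k)\<^sup>\<dagger> = (1 / 4) \<cdot>\<^sub>m (V k * (\<Delta> \<oplus>\<^sub>m \<Delta>) * (V k)\<^sup>\<dagger>)"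
      unfolding mult_smult_distrib[OF Vc[OF that] \<Delta>\<Delta>]
      by (rule mult_smult_assoc_mat[OF VD adjoint_carrier[OF Vc[OF that]]])
  qed
  have "H \<oplus>\<^sub>m H = mat_sum ?N ?N (\<lambda>k. (1 / 4) \<cdot>\<^sub>m (V k * (\<Delta> \<oplus>\<^sub>m \<Delta>) * (V k)\<^sup>\<dagger>)) {1..4}"
    unfolding TT[symmetric] dec by (rule mat_sum_cong) (rule Vk)
  also have "\<dots> = (1 / 4) \<cdot>\<^sub>m mat_sum ?N ?N (\<lambda>k. V k * (\<Delta> \<oplus>\<^sub>m \<Delta>) * (V k)\<^sup>\<dagger>) {1..4}"
    by (rule mat_sum_smult) (rule Vkc)
  finally have sum: "H \<oplus>\<^sub>m H = (1 / 4) \<cdot>\<^sub>m mat_sum ?N ?N (\<lambda>k. V k * (\<Delta> \<oplus>\<^sub>m \<Delta>) * (V k)\<^sup>\<dagger>) {1..4}" .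
  have dims: "2 * \<beta> * n = ?N" "2 * n = n + n" by (simp_all add: mult_2 distrib_right)
  show ?thesis
    unfolding dims by (intro exI[of _ V] conjI ballI) (fact V, fact sum)
qed

end
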